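(* For any two different partitions $\lambda\neq\mu$ of the same positive integer $k$, the simplicial complexes $K_\lambda$ and $K_\mu$ are not isomorphic (not combinatorially equivalent).
   Context: For $m\ge1$, $C_m$ denotes the chain $0<1<\cdots<m$. For a partition $\lambda=(\lambda_1,\ldots,\lambda_s)$ of $k$ (positive parts), $P_\lambda=C_{\lambda_1}\times\cdots\times C_{\lambda_s}$ with componentwise order, with minimum $\hat0$ and maximum $\hat1$, and $K_\lambda=\Delta(P_\lambda\setminus\{\hat0,\hat1\})$ is the order complex (faces = chains) of the proper part of $P_\lambda$. *)

theory Defs
  imports Main
begin

definition partition_of :: "nat \<Rightarrow> nat list \<Rightarrow> bool" where
  "partition_of k lam \<longleftrightarrow> sorted_wrt (\<ge>) lam \<and> (\<forall>p\<in>set lam. 0 < p) \<and> sum_list lam = k"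

(* The chain C_m is the set {0..m} with the usual order of nat; an element of a
   product of chains is the list of its coordinates. *)
definition chain_product :: "nat list \<Rightarrow> nat list set" where
  "chain_product lam = listset (map (\<lambda>m. {0..m}) lam)"

abbreviation cw_le :: "nat list \<Rightarrow> nat list \<Rightarrow> bool" where
  "cw_le \<equiv> list_all2 (\<le>)"

definition bottom_elt :: "nat list \<Rightarrow> nat list" where
  "bottom_elt lam = replicate (length lam) 0"

definition top_elt :: "nat list \<Rightarrow> nat list" where
  "top_elt lam = lam"

lemma mem_chain_product: "x \<in> chain_product lam \<longleftrightarrow> cw_le x lam"
proof (induction lam arbitrary: x)
  case Nil
  then show ?case by (simp add: chain_product_def)
next
  case (Cons m lam)
  then show ?case
    by (cases x) (auto simp: chain_product_def set_Cons_def)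
qed

lemma bottom_elt_least:
  "bottom_elt lam \<in> chain_product lam"
  "x \<in> chain_product lam \<Longrightarrow> cw_le (bottom_elt lam) x"
  by (auto simp: bottom_elt_def mem_chain_product list_all2_conv_all_nth)

lemma top_elt_greatest:
  "top_elt lam \<in> chain_product lam"
  "x \<in> chain_product lam \<Longrightarrow> cw_le x (top_elt lam)"
  by (auto simp: top_elt_def mem_chain_product list_all2_conv_all_nth)

definition proper_part :: "nat list \<Rightarrow> nat list set" where
  "proper_part lam = chain_product lam - {bottom_elt lam, top_elt lam}"

(* Abstract simplicial complexes are represented by their sets of faces,
   the empty face included. *)
definition order_complex :: "'a set \<Rightarrow> ('a \<Rightarrow> 'a \<Rightarrow> bool) \<Rightarrow> 'a set set" where
  "order_complex A le = {F. F \<subseteq> A \<and> finite F \<and> Complete_Partial_Order.chain le F}"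

definition K_complex :: "nat list \<Rightarrow> nat list set set" where
  "K_complex lam = order_complex (proper_part lam) cw_le"

definition vertices :: "'a set set \<Rightarrow> 'a set" where
  "vertices K = {v. {v} \<in> K}"

definition simplicial_iso :: "'a set set \<Rightarrow> 'b set set \<Rightarrow> bool" where
  "simplicial_iso K L \<longleftrightarrow>
     (\<exists>f. bij_betw f (vertices K) (vertices L) \<and>
          (\<forall>F. F \<subseteq> vertices K \<longrightarrow> (F \<in> K \<longleftrightarrow> f ` F \<in> L)))"

end

theory Submission
  imports Defs "HOL-Library.Multiset" "HOL-Computational_Algebra.Primes"
begin

text \<open>
  Sending the minimum to the minimum and the maximum to the maximum extends an isomorphism
  of the order complexes to a bijection of the full products of chains that preserves comparability.
  Hence the number of multisets of size n with pairwise comparable elements, which is the number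
  of weakly increasing sequences of length n, is the same for both products. For a product of chains
  this number is the product of the binomial coefficients (m + n choose n) over the parts m. These
  values determine the largest part a: for a prime p > a and n = p - a the factor of a is
  (p choose n), a multiple of p, whereas smaller parts m give m + n < p and no factor p. Cancel the
  largest part and repeat.
\<close>

section \<open>Multichains in products of chains\<close>

text \<open>For a finite partial order, the cardinality as a function of \<open>n\<close> is the
  zeta polynomial of the poset at \<open>n + 1\<close>.\<close>

definition multichains :: "'a set \<Rightarrow> ('a \<Rightarrow> 'a \<Rightarrow> bool) \<Rightarrow> nat \<Rightarrow> 'a list set" where
  "multichains A le n = {xs. length xs = n \<and> set xs \<subseteq> A \<and> sorted_wrt le xs}"

lemma finite_multichains: "finite A \<Longrightarrow> finite (multichains A le n)"
  by (rule finite_subset[OF _ finite_lists_length_eq[of A n]]) (auto simp: multichains_def)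

text \<open>Pascal's rule: a nonempty weakly increasing sequence either starts with 0, and dropping
  that entry shortens it, or has only positive entries, and subtracting 1 from each lowers the bound
  \<open>m\<close>. Both moves decrease \<open>m + n\<close>, the induction measure.\<close>

lemma card_multichains_chain: "card (multichains {0..m::nat} (\<le>) n) = (m + n) choose n"
proof (induction "m + n" arbitrary: m n)
  case 0
  then have "multichains {0..m} (\<le>) n = {[]}"
    by (auto simp: multichains_def)
  then show ?case using 0 by simp
next
  case (Suc k)
  show ?case
  proof (cases "m = 0 \<or> n = 0")
    case True
    then have "multichains {0..m} (\<le>) n = {replicate n 0}"
      by (auto simp: multichains_def chain_product_def sorted_wrt_iff_nth_less intro!: replicate_eqI)
    then show ?thesis using True by (elim disjE) simp_all
  next
    case False
    then obtain m' n' where mn: "m = Suc m'" "n = Suc n'"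
      by (metis not0_implies_Suc)
    let ?A = "(#) 0 ` multichains {0..m} (\<le>) n'"
    let ?B = "map Suc ` multichains {0..m'} (\<le>) n"
    have eq: "multichains {0..m} (\<le>) n = ?A \<union> ?B"
    proof (intro equalityI subsetI)
      fix xs assume xs: "xs \<in> multichains {0..m} (\<le>) n"
      then obtain y ys where y: "xs = y # ys"
        by (cases xs) (auto simp: multichains_def mn)
      show "xs \<in> ?A \<union> ?B"
      proof (cases "y = 0")
        case True
        then show ?thesis using xs y by (auto simp: multichains_def mn)
      next
        case False
        then have pos: "\<forall>x\<in>set xs. 0 < x"
          using xs y by (auto simp: multichains_def)
        then have "xs = map Suc (map (\<lambda>x. x - 1) xs)"
          by (simp add: map_idI)
        moreover have "map (\<lambda>x. x - 1) xs \<in> multichains {0..m'} (\<le>) n"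
          using xs mn unfolding multichains_def
          by (auto simp: sorted_wrt_iff_nth_less diff_le_mono)
        ultimately show ?thesis by blast
      qed
    next
      fix xs assume "xs \<in> ?A \<union> ?B"
      then show "xs \<in> multichains {0..m} (\<le>) n"
        by (auto simp: multichains_def mn sorted_wrt_map subset_iff)
    qed
    have disj: "?A \<inter> ?B = {}"
      by (auto simp: multichains_def)
    have "card (multichains {0..m} (\<le>) n) = card ?A + card ?B"
      unfolding eq by (rule card_Un_disjoint) (use disj in \<open>auto intro!: finite_multichains\<close>)
    also have "card ?A = card (multichains {0..m} (\<le>) n')"
      by (rule card_image) auto
    also have "card ?B = card (multichains {0..m'} (\<le>) n)"
      by (rule card_image) (auto intro: inj_on_subset[OF _ subset_UNIV])
    also have "card (multichains {0..m} (\<le>) n') + card (multichains {0..m'} (\<le>) n)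
        = ((m + n') choose n') + ((m' + n) choose n)"
      using Suc.hyps(1)[of m n'] Suc.hyps(1)[of m' n] Suc.hyps(2) mn by simp
    also have "\<dots> = (m + n) choose n"
      by (simp add: mn)
    finally show ?thesis .
  qed
qed

text \<open>The order is componentwise, so splitting every entry into head and tail turns a
  multichain of the product into an independent pair of multichains, one in the first chain and one
  in the remaining product.\<close>

lemma card_multichains_chain_product:
  "card (multichains (chain_product lam) cw_le n) = (\<Prod>m\<leftarrow>lam. (m + n) choose n)"
proof (induction lam)
  case Nil
  have "multichains (chain_product []) cw_le n = {replicate n []}"
    by (auto simp: multichains_def chain_product_def sorted_wrt_iff_nth_less intro!: replicate_eqI)
  then show ?case by simp
next
  case (Cons m lam)
  have "bij_betw (\<lambda>(us, vs). map2 (#) us vs)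
      (multichains {0..m} (\<le>) n \<times> multichains (chain_product lam) cw_le n)
      (multichains (chain_product (m # lam)) cw_le n)"
  proof (rule bij_betw_byWitness[where f' = "\<lambda>xs. (map hd xs, map tl xs)"])
    show "\<forall>a\<in>multichains {0..m} (\<le>) n \<times> multichains (chain_product lam) cw_le n.
       (map hd (case a of (us, vs) \<Rightarrow> map2 (#) us vs), map tl (case a of (us, vs) \<Rightarrow> map2 (#) us vs)) = a"
      by (auto simp: multichains_def intro!: nth_equalityI)
    \<comment> \<open>Nonempty entries are what makes \<open>hd\<close> and \<open>tl\<close>
      inverse to consing.\<close>
    have ne: "xs ! i \<noteq> []" if "xs \<in> multichains (chain_product (m # lam)) cw_le n" "i < length xs" for xs i
    proof
      assume "xs ! i = []"
      moreover have "xs ! i \<in> chain_product (m # lam)"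
        using that nth_mem unfolding multichains_def by blast
      ultimately show False by (simp add: mem_chain_product)
    qed
    then show "\<forall>a'\<in>multichains (chain_product (m # lam)) cw_le n.
       (case (map hd a', map tl a') of (us, vs) \<Rightarrow> map2 (#) us vs) = a'"
      by (auto intro!: nth_equalityI)
    show "(\<lambda>(us, vs). map2 (#) us vs) ` (multichains {0..m} (\<le>) n \<times> multichains (chain_product lam) cw_le n)
      \<subseteq> multichains (chain_product (m # lam)) cw_le n"
    proof clarify
      fix us vs
      assume us: "us \<in> multichains {0..m} (\<le>) n" and vs: "vs \<in> multichains (chain_product lam) cw_le n"
      have "cw_le (us ! i # vs ! i) (m # lam)" if "i < n" for i
      proof -
        have "us ! i \<in> set us" "vs ! i \<in> set vs"
          using us vs that by (auto simp: multichains_def)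
        then have "us ! i \<in> {0..m}" "vs ! i \<in> chain_product lam"
          using us vs by (auto simp: multichains_def)
        then show ?thesis by (simp add: mem_chain_product)
      qed
      then show "map2 (#) us vs \<in> multichains (chain_product (m # lam)) cw_le n"
        using us vs by (auto simp: multichains_def sorted_wrt_iff_nth_less mem_chain_product set_zip)
    qed
    have "(map hd xs, map tl xs) \<in> multichains {0..m} (\<le>) n \<times> multichains (chain_product lam) cw_le n"
      if xs: "xs \<in> multichains (chain_product (m # lam)) cw_le n" for xs
    proof -
      have "hd x \<le> m \<and> cw_le (tl x) lam" if "x \<in> set xs" for x
        using xs that by (cases x) (auto simp: multichains_def mem_chain_product)
      moreover have "hd (xs ! i) \<le> hd (xs ! j) \<and> cw_le (tl (xs ! i)) (tl (xs ! j))"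
        if "i < j" "j < length xs" for i j
      proof -
        have "cw_le (xs ! i) (xs ! j)"
          using xs that by (auto simp: multichains_def sorted_wrt_iff_nth_less)
        then show ?thesis
          using ne[OF xs, of i] that by (cases "xs ! i"; cases "xs ! j") auto
      qed
      ultimately show ?thesis
        using xs by (auto simp: multichains_def sorted_wrt_iff_nth_less mem_chain_product)
    qed
    then show "(\<lambda>xs. (map hd xs, map tl xs)) ` multichains (chain_product (m # lam)) cw_le n
      \<subseteq> multichains {0..m} (\<le>) n \<times> multichains (chain_product lam) cw_le n"
      by blast
  qed
  then have "card (multichains (chain_product (m # lam)) cw_le n)
      = card (multichains {0..m} (\<le>) n \<times> multichains (chain_product lam) cw_le n)"
    by (metis bij_betw_same_card)
  then show ?case
    by (simp add: card_cartesian_product card_multichains_chain Cons.IH)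
qed

section \<open>Multichains as multisets of pairwise comparable elements\<close>

text \<open>Each head occurs in the other list, so if they differ, each lies below the other, and
  antisymmetry makes them equal.\<close>

lemma sorted_wrt_mset_unique:
  assumes "antisymp le" "sorted_wrt le xs" "sorted_wrt le ys" "mset xs = mset ys"
  shows "xs = ys"
  using assms(2-4)
proof (induction xs arbitrary: ys)
  case Nil
  then show ?case by simp
next
  case (Cons x xs)
  then obtain y zs where ys: "ys = y # zs"
    by (cases ys) auto
  have "x \<in> set ys" "y \<in> set (x # xs)"
    using Cons.prems(3) ys by (metis list.set_intros(1) set_mset_mset)+
  then have "x = y"
    using Cons.prems ys antisympD[OF assms(1)] by auto
  then show ?case
    using Cons ys by auto
qed

lemma antisymp_cw_le: "antisymp cw_le"
  by (auto intro!: antisympI nth_equalityI simp: list_all2_conv_all_nth le_antisym)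

text \<open>The coordinate sum is strictly monotone, so on comparable elements it decides the
  direction of the order. This lets a chain be sorted by a numerical key.\<close>

lemma cw_le_of_sum_list_le:
  assumes "cw_le x y \<or> cw_le y x" "sum_list x \<le> sum_list y"
  shows "cw_le x y"
proof -
  have "sum_list b \<le> sum_list a \<Longrightarrow> a = b" if "cw_le a b" for a b :: "nat list"
    using that
  proof (induction rule: list_all2_induct)
    case (Cons u us v vs)
    have "sum_list us \<le> sum_list vs"
      using Cons.hyps(2) by (induction rule: list_all2_induct) auto
    then show ?case using Cons by auto
  qed auto
  then show ?thesis using assms by blast
qed

text \<open>Unlike sorted lists, this notion sees only comparability and not its direction. That
  matters because an isomorphism of order complexes may reverse the order.\<close>

definition chain_multisets :: "'a set \<Rightarrow> ('a \<Rightarrow> 'a \<Rightarrow> bool) \<Rightarrow> nat \<Rightarrow> 'a multiset set" where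
  "chain_multisets A le n =
     {M. size M = n \<and> set_mset M \<subseteq> A \<and> Complete_Partial_Order.chain le (set_mset M)}"

lemma chain_set_of_sorted_wrt:
  "reflp le \<Longrightarrow> sorted_wrt le xs \<Longrightarrow> Complete_Partial_Order.chain le (set xs)"
  by (induction xs) (auto simp: chain_def reflp_def)

text \<open>Forgetting the order of a multichain loses nothing: \<open>mset\<close> is injective by
  uniqueness of sorted lists, and surjective because a multiset of comparable elements can be
  sorted.\<close>

lemma card_chain_multisets_cw_le: "card (chain_multisets A cw_le n) = card (multichains A cw_le n)"
proof -
  have "mset ` multichains A cw_le n = chain_multisets A cw_le n"
  proof (intro equalityI subsetI)
    fix M assume "M \<in> mset ` multichains A cw_le n"
    then show "M \<in> chain_multisets A cw_le n"
      by (auto simp: multichains_def chain_multisets_def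
          intro!: chain_set_of_sorted_wrt list_all2_refl reflpI)
  next
    fix M assume M: "M \<in> chain_multisets A cw_le n"
    obtain xs where xs: "mset xs = M"
      using ex_mset by blast
    \<comment> \<open>Sorting by coordinate sum sorts by \<open>cw_le\<close>, as all entries are
      comparable; a tie in the sum forces equality.\<close>
    let ?ys = "sort_key sum_list xs"
    have "sorted_wrt (\<lambda>x y. sum_list x \<le> sum_list y) ?ys"
      using sorted_sort_key[of sum_list xs] by (simp add: sorted_wrt_map)
    then have "sorted_wrt cw_le ?ys"
    proof (rule sorted_wrt_mono_rel[rotated])
      fix x y assume "x \<in> set ?ys" "y \<in> set ?ys" "sum_list x \<le> sum_list y"
      then show "cw_le x y"
        using M xs unfolding chain_multisets_def chain_def
        by (metis (lifting) cw_le_of_sum_list_le mem_Collect_eq set_mset_mset set_sort)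
    qed
    then have "?ys \<in> multichains A cw_le n"
      using M xs by (auto simp: multichains_def chain_multisets_def)
    then show "M \<in> mset ` multichains A cw_le n"
      using xs by (metis image_eqI mset_sort)
  qed
  moreover have "inj_on mset (multichains A cw_le n)"
    by (auto simp: inj_on_def multichains_def intro: sorted_wrt_mset_unique[OF antisymp_cw_le])
  ultimately show ?thesis
    by (metis card_image)
qed

lemma card_chain_multisets_eq:
  assumes g: "bij_betw g A B"
    and comp: "\<And>x y. x \<in> A \<Longrightarrow> y \<in> A \<Longrightarrow> le x y \<or> le y x \<longleftrightarrow> le' (g x) (g y) \<or> le' (g y) (g x)"
  shows "card (chain_multisets A le n) = card (chain_multisets B le' n)"
proof -
  let ?h = "inv_into A g"
  have gh: "g (?h y) = y" "?h y \<in> A" if "y \<in> B" for y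
    using that bij_betw_inv_into_right[OF g] bij_betw_apply[OF bij_betw_inv_into[OF g]] by simp_all
  have hg: "?h (g x) = x" "g x \<in> B" if "x \<in> A" for x
    using that bij_betw_inv_into_left[OF g] bij_betw_apply[OF g] by simp_all
  have "bij_betw (image_mset g) (chain_multisets A le n) (chain_multisets B le' n)"
  proof (rule bij_betw_byWitness[where f' = "image_mset ?h"])
    show "\<forall>M\<in>chain_multisets A le n. image_mset ?h (image_mset g M) = M"
      by (auto simp: chain_multisets_def multiset.map_comp subset_iff hg
          intro!: multiset.map_ident_strong)
    show "\<forall>M\<in>chain_multisets B le' n. image_mset g (image_mset ?h M) = M"
      by (auto simp: chain_multisets_def multiset.map_comp subset_iff gh
          intro!: multiset.map_ident_strong)
    show "image_mset g ` chain_multisets A le n \<subseteq> chain_multisets B le' n"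
      using comp by (fastforce simp: chain_multisets_def chain_def hg)
    show "image_mset ?h ` chain_multisets B le' n \<subseteq> chain_multisets A le n"
    proof (clarsimp simp: chain_multisets_def, intro conjI)
      fix M assume M: "set_mset M \<subseteq> B" "Complete_Partial_Order.chain le' (set_mset M)"
      then show "?h ` set_mset M \<subseteq> A" by (auto simp: gh)
      show "Complete_Partial_Order.chain le (?h ` set_mset M)"
        using M comp[of "?h x" "?h y" for x y] unfolding chain_def by (simp add: subset_iff gh)
    qed
  qed
  then show ?thesis by (rule bij_betw_same_card)
qed

section \<open>From isomorphic order complexes to equal multichain counts\<close>

lemma vertices_K_complex: "vertices (K_complex lam) = proper_part lam"
  by (auto simp: vertices_def K_complex_def order_complex_def chain_def list_all2_refl)

lemma edge_in_K_complex_iff: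
  "{x, y} \<in> K_complex lam \<longleftrightarrow>
     x \<in> proper_part lam \<and> y \<in> proper_part lam \<and> (cw_le x y \<or> cw_le y x)"
  by (auto simp: K_complex_def order_complex_def chain_def list_all2_refl)

lemma top_neq_bottom:
  assumes "partition_of k lam" "1 \<le> k"
  shows "bottom_elt lam \<noteq> top_elt lam"
  using assms by (cases lam) (auto simp: partition_of_def bottom_elt_def top_elt_def)

lemma simplicial_iso_prod_choose_eq:
  assumes iso: "simplicial_iso (K_complex lam) (K_complex mu)"
    and lam: "bottom_elt lam \<noteq> top_elt lam" and mu: "bottom_elt mu \<noteq> top_elt mu"
  shows "(\<Prod>m\<leftarrow>lam. (m + n) choose n) = (\<Prod>m\<leftarrow>mu. (m + n) choose n)"
proof -
  obtain f where f: "bij_betw f (proper_part lam) (proper_part mu)"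
    and faces: "\<And>F. F \<subseteq> proper_part lam \<Longrightarrow> F \<in> K_complex lam \<longleftrightarrow> f ` F \<in> K_complex mu"
    using iso unfolding simplicial_iso_def vertices_K_complex by blast
  \<comment> \<open>The two updates do not collide, since bottom and top of \<open>lam\<close>
    differ; as those of \<open>mu\<close> differ too, \<open>g\<close> stays injective.\<close>
  define g where "g = f(bottom_elt lam := bottom_elt mu, top_elt lam := top_elt mu)"
  have insert: "chain_product nu = insert (top_elt nu) (insert (bottom_elt nu) (proper_part nu))" for nu
    using bottom_elt_least(1) top_elt_greatest(1) by (auto simp: proper_part_def)
  have notin: "bottom_elt nu \<notin> proper_part nu" "top_elt nu \<notin> proper_part nu" for nu
    by (auto simp: proper_part_def)
  have g_simps: "g (bottom_elt lam) = bottom_elt mu" "g (top_elt lam) = top_elt mu"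
    "\<And>x. x \<in> proper_part lam \<Longrightarrow> g x = f x"
    using lam notin by (auto simp: g_def)
  have "bij_betw g (proper_part lam) (proper_part mu)"
    using f g_simps(3) by (metis bij_betw_cong)
  then have bij: "bij_betw g (chain_product lam) (chain_product mu)"
    unfolding insert using lam mu notin
    by (auto simp: bij_betw_def g_simps)
  have "cw_le x y \<or> cw_le y x \<longleftrightarrow> cw_le (g x) (g y) \<or> cw_le (g y) (g x)"
    if xy: "x \<in> chain_product lam" "y \<in> chain_product lam" for x y
  proof (cases "x \<in> proper_part lam \<and> y \<in> proper_part lam")
    case True
    then show ?thesis
      \<comment> \<open>Comparability in the proper part is membership of \<open>{x, y}\<close> in
        the complex, which \<open>f\<close> preserves; for \<open>x = y\<close> this is a
        vertex.\<close>
      using faces[of "{x, y}"] bij_betw_apply[OF f] by (simp add: edge_in_K_complex_iff g_simps)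
  next
    case False
    then have "x \<in> {bottom_elt lam, top_elt lam} \<or> y \<in> {bottom_elt lam, top_elt lam}"
      using xy by (auto simp: proper_part_def)
    moreover have "g x \<in> chain_product mu" "g y \<in> chain_product mu"
      using xy bij_betw_apply[OF bij] by auto
    \<comment> \<open>An extremal element is comparable to everything, and \<open>g\<close> sends
      extremal elements to extremal ones, so both sides hold.\<close>
    ultimately show ?thesis
      using xy bottom_elt_least(2) top_elt_greatest(2) by (auto simp: g_simps)
  qed
  then have "card (chain_multisets (chain_product lam) cw_le n)
      = card (chain_multisets (chain_product mu) cw_le n)"
    by (rule card_chain_multisets_eq[OF bij])
  then show ?thesis
    by (simp add: card_chain_multisets_cw_le card_multichains_chain_product)
qed

section \<open>Recovering a partition from products of binomial coefficients\<close>

text \<open>Each factor divides \<open>fact (b + n)\<close>, whose prime divisors are at most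
  \<open>b + n\<close> and hence below \<open>p\<close>.\<close>

lemma prime_not_dvd_prod_choose:
  fixes p :: nat
  assumes "prime p" "\<forall>b\<in>set mu. b + n < p"
  shows "\<not> p dvd (\<Prod>m\<leftarrow>mu. (m + n) choose n)"
  using assms(2)
proof (induction mu)
  case Nil
  then show ?case using assms(1) by auto
next
  case (Cons b mu)
  have "(b + n) choose n dvd fact (b + n)"
    using binomial_fact_lemma[of n "b + n"] by (metis dvd_triv_right le_add2)
  moreover have "\<not> p dvd fact (b + n)"
    using Cons.prems assms(1) by (simp add: prime_dvd_fact_iff)
  ultimately have "\<not> p dvd (b + n) choose n"
    using dvd_trans by blast
  then show ?case
    using Cons assms(1) by (simp add: prime_dvd_mult_iff)
qed

lemma hd_le_of_prod_choose_eq: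
  assumes eq: "\<And>n. (\<Prod>m\<leftarrow>a # lam. (m + n) choose n) = (\<Prod>m\<leftarrow>mu. (m + n) choose n)"
    and a: "0 < a"
  shows "\<exists>b\<in>set mu. a \<le> b"
proof (rule ccontr)
  assume "\<not> ?thesis"
  then have less: "\<forall>b\<in>set mu. b < a" by auto
  obtain p :: nat where p: "prime p" "a < p"
    using bigger_prime by blast
  \<comment> \<open>Here \<open>0 < p - a < p\<close>, so the prime in the numerator of the binomial
    coefficient does not cancel.\<close>
  have "p dvd p choose (p - a)"
    using p a by (intro dvd_choose_prime) auto
  then have "p dvd (\<Prod>m\<leftarrow>a # lam. (m + (p - a)) choose (p - a))"
    using p by simp
  moreover have "\<not> p dvd (\<Prod>m\<leftarrow>mu. (m + (p - a)) choose (p - a))"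
    using p less by (intro prime_not_dvd_prod_choose) auto
  ultimately show False by (simp only: eq)
qed

text \<open>Applying \<open>hd_le_of_prod_choose_eq\<close> in both directions bounds each head by a
  part of the other list, hence by its head, so the heads agree and their common factor
  cancels.\<close>

lemma prod_choose_determines_partition:
  assumes "sorted_wrt (\<ge>) lam" "\<forall>m\<in>set lam. 0 < m" "sorted_wrt (\<ge>) mu" "\<forall>m\<in>set mu. 0 < m"
    and "\<And>n. (\<Prod>m\<leftarrow>lam. (m + n) choose n) = (\<Prod>m\<leftarrow>mu. (m + n) choose n)"
  shows "lam = mu"
  using assms
proof (induction lam arbitrary: mu)
  case Nil
  show ?case
  proof (cases mu)
    case (Cons b mu')
    \<comment> \<open>With the roles exchanged, the head \<open>b\<close> would be bounded by a
      member of the empty list.\<close>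
    then show ?thesis
      using hd_le_of_prod_choose_eq[of b mu' "[]"] Nil.prems by simp
  qed simp
next
  case (Cons a lam)
  obtain b where b: "b \<in> set mu" "a \<le> b"
    using hd_le_of_prod_choose_eq[OF Cons.prems(5)] Cons.prems(2) by auto
  then obtain c mu' where mu: "mu = c # mu'" by (cases mu) auto
  have "a \<le> c" using b Cons.prems(3) mu by auto
  moreover have "\<exists>b\<in>set (a # lam). c \<le> b"
    using hd_le_of_prod_choose_eq[of c mu' "a # lam"] Cons.prems(4,5) mu by simp
  then have "c \<le> a" using Cons.prems(1) by auto
  ultimately have "a = c" by simp
  moreover have "lam = mu'"
  proof (rule Cons.IH)
    fix n
    have "0 < (a + n) choose n" by simp
    \<comment> \<open>Positivity of the common factor permits cancellation; deleting the simp rule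
      keeps that fact from being simplified away.\<close>
    then show "(\<Prod>m\<leftarrow>lam. (m + n) choose n) = (\<Prod>m\<leftarrow>mu'. (m + n) choose n)"
      using Cons.prems(5)[of n] mu \<open>a = c\<close> by (auto simp del: zero_less_binomial_iff)
  qed (use Cons.prems mu in auto)
  ultimately show ?case using mu by simp
qed

theorem mainTheorem5:
  fixes k :: nat and lam mu :: "nat list"
  assumes "1 \<le> k"
    and "partition_of k lam"
    and "partition_of k mu"
    and "lam \<noteq> mu"
  shows "\<not> simplicial_iso (K_complex lam) (K_complex mu)"
proof
  assume "simplicial_iso (K_complex lam) (K_complex mu)"
  then have "(\<Prod>m\<leftarrow>lam. (m + n) choose n) = (\<Prod>m\<leftarrow>mu. (m + n) choose n)" for n
    using assms top_neq_bottom by (intro simplicial_iso_prod_choose_eq) auto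
  then have "lam = mu"
    using assms(2,3) by (intro prod_choose_determines_partition) (auto simp: partition_of_def)
  then show False using assms(4) by contradiction
qed

end
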